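(* Let $\lambda$ be an infinite cardinal. The family $$\{\Delta(\mathscr{I}^{\infty}_\lambda),\Omega(\mathscr{I}^{\infty}_\lambda)\}\cup\{\mathfrak{K}_n(\textsf{S}_\infty)\mid n=0,1,2,\ldots\}\cup\{\mathfrak{K}_n(\textsf{A}_\infty)\mid n=0,1,2,\ldots\}\cup\{\mathfrak{K}_n(I)\mid n=1,2,\ldots\}$$ is the set of all congruences on the semigroup $\mathscr{I}^{\infty}_\lambda$.
   Context: For an infinite cardinal $\lambda$ (regarded as a set), $\mathscr{I}_\lambda$ is the symmetric inverse semigroup of all partial one-to-one maps from $\lambda$ to $\lambda$; maps are written on the right and composed left to right: $(x)(\alpha\beta)=((x)\alpha)\beta$ for $x\in\operatorname{dom}(\alpha\beta)=\{y\in\operatorname{dom}\alpha\mid (y)\alpha\in\operatorname{dom}\beta\}$. A map $\alpha\in\mathscr{I}_\lambda$ is almost everywhere the identity if $\lambda\setminus\operatorname{dom}\alpha$ is finite and $(x)\alpha\neq x$ only for finitely many $x\in\operatorname{dom}\alpha$. $\mathscr{I}^{\infty}_\lambda\subseteq\mathscr{I}_\lambda$ is the inverse subsemigroup of all such maps. $\mathscr{H}$ is Green's relation $\mathscr{L}\cap\mathscr{R}$ on $\mathscr{I}^{\infty}_\lambda$, where $a\mathscr{R}b\iff aS^1=bS^1$ and $a\mathscr{L}b\iff S^1a=S^1b$ in a semigroup $S$. $\Delta(S)=\{(s,s)\mid s\in S\}$ and $\Omega(S)=S\times S$ are the identity and universal congruences. For a non-negative integer $n$ let $I_n=\{\alpha\in\mathscr{I}^{\infty}_\lambda\mid|\lambda\setminus\operatorname{dom}\alpha|\geqslant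 n\}$, and define: $\bullet$ $\mathfrak{K}_n(I)=(I_n\times I_n)\cup\Delta(\mathscr{I}^{\infty}_\lambda)$. $\bullet$ $\mathfrak{K}_n(\textsf{S}_\infty)=\{(\alpha,\beta)\mid \alpha\mathscr{H}\beta,\ |\lambda\setminus\operatorname{dom}\alpha|=|\lambda\setminus\operatorname{dom}\beta|=n\}\cup(I_{n+1}\times I_{n+1})\cup\Delta(\mathscr{I}^{\infty}_\lambda)$. $\bullet$ $\mathfrak{K}_n(\textsf{A}_\infty)=\{(\alpha,\beta)\mid \alpha\mathscr{H}\beta,\ \alpha\cdot\beta^{-1}\text{ is an even permutation of }\operatorname{dom}\alpha,\ |\lambda\setminus\operatorname{dom}\alpha|=|\lambda\setminus\operatorname{dom}\beta|=n\}\cup(I_{n+1}\times I_{n+1})\cup\Delta(\mathscr{I}^{\infty}_\lambda)$. Here a permutation moving only finitely many points is even if it is a product of an even number of transpositions. *)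

theory Defs
  imports "HOL-Algebra.Coset" "HOL-Combinatorics.Permutations"
begin

section \<open>Semigroups: Green's relations and congruences\<close>

text \<open>
  A semigroup is given by a record \<open>S\<close> of type \<open>monoid\<close>; the definitions of this section use only
  its carrier and its multiplication. For every \<open>a\<close> in \<open>S\<close>, the set \<open>a S\<^sup>1\<close> is
  \<open>{a} \<union> a S\<close>, whether or not \<open>S\<close> already has an identity, and dually for \<open>S\<^sup>1 a\<close>.
\<close>

definition principal_right_ideal :: "('a, 'm) monoid_scheme \<Rightarrow> 'a \<Rightarrow> 'a set" where
  "principal_right_ideal S a = insert a (a <#\<^bsub>S\<^esub> carrier S)"

definition principal_left_ideal :: "('a, 'm) monoid_scheme \<Rightarrow> 'a \<Rightarrow> 'a set" where
  "principal_left_ideal S a = insert a (carrier S #>\<^bsub>S\<^esub> a)"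

definition green_R :: "('a, 'm) monoid_scheme \<Rightarrow> 'a rel" where
  "green_R S = {(a, b) \<in> carrier S \<times> carrier S.
                  principal_right_ideal S a = principal_right_ideal S b}"

definition green_L :: "('a, 'm) monoid_scheme \<Rightarrow> 'a rel" where
  "green_L S = {(a, b) \<in> carrier S \<times> carrier S.
                  principal_left_ideal S a = principal_left_ideal S b}"

definition green_H :: "('a, 'm) monoid_scheme \<Rightarrow> 'a rel" where
  "green_H S = green_L S \<inter> green_R S"

definition congruence_on :: "('a, 'm) monoid_scheme \<Rightarrow> 'a rel \<Rightarrow> bool" where
  "congruence_on S r \<longleftrightarrow> equiv (carrier S) r \<and>
     (\<forall>(a, b) \<in> r. \<forall>c \<in> carrier S.
        (c \<otimes>\<^bsub>S\<^esub> a, c \<otimes>\<^bsub>S\<^esub> b) \<in> r \<and> (a \<otimes>\<^bsub>S\<^esub> c, b \<otimes>\<^bsub>S\<^esub> c) \<in> r)"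

definition Delta :: "('a, 'm) monoid_scheme \<Rightarrow> 'a rel" where
  "Delta S = Id_on (carrier S)"

definition Omega :: "('a, 'm) monoid_scheme \<Rightarrow> 'a rel" where
  "Omega S = carrier S \<times> carrier S"


section \<open>Partial one-to-one maps that are almost everywhere the identity\<close>

definition partial_injections :: "'a set \<Rightarrow> ('a \<rightharpoonup> 'a) set" where
  "partial_injections A = {\<alpha>. dom \<alpha> \<subseteq> A \<and> ran \<alpha> \<subseteq> A \<and> inj_on \<alpha> (dom \<alpha>)}"

definition almost_identity :: "'a set \<Rightarrow> ('a \<rightharpoonup> 'a) \<Rightarrow> bool" where
  "almost_identity A \<alpha> \<longleftrightarrow> finite (A - dom \<alpha>) \<and> finite {x \<in> dom \<alpha>. \<alpha> x \<noteq> Some x}"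

text \<open>
  Maps are composed from left to right, so the product of \<open>\<alpha>\<close> and \<open>\<beta>\<close> is \<open>\<beta> \<circ>\<^sub>m \<alpha>\<close>.
\<close>

definition I_inf :: "'a set \<Rightarrow> ('a \<rightharpoonup> 'a) monoid" where
  "I_inf A = \<lparr>carrier = {\<alpha> \<in> partial_injections A. almost_identity A \<alpha>},
              monoid.mult = (\<lambda>\<alpha> \<beta>. \<beta> \<circ>\<^sub>m \<alpha>),
              one = Some |` A\<rparr>"

definition pinv :: "('a \<rightharpoonup> 'a) \<Rightarrow> ('a \<rightharpoonup> 'a)" where
  "pinv \<alpha> = (\<lambda>y. if y \<in> ran \<alpha> then Some (THE x. \<alpha> x = Some y) else None)"

lemma pinv_eq_Some_iff:
  assumes "inj_on \<alpha> (dom \<alpha>)"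
  shows "pinv \<alpha> y = Some x \<longleftrightarrow> \<alpha> x = Some y"
proof -
  have uniq: "x' = x" if "\<alpha> x = Some y" "\<alpha> x' = Some y" for x x'
    using inj_onD[OF assms, of x' x] that by (simp add: domI)
  have the: "(THE x'. \<alpha> x' = Some y) = x" if "\<alpha> x = Some y" for x
    using that uniq by (intro the_equality) auto
  show ?thesis
  proof (cases "y \<in> ran \<alpha>")
    case True
    then obtain z where z: "\<alpha> z = Some y"
      by (auto simp: ran_def)
    show ?thesis
      using True z the[OF z] uniq by (auto simp: pinv_def)
  next
    case False
    then show ?thesis
      by (auto simp: pinv_def ran_def)
  qed
qed

text \<open>
  The library represents a permutation of \<open>D\<close> as a total function that is the identity outside
  \<open>D\<close>, whereas \<open>\<gamma>\<close> below is a partial map with domain \<open>D\<close>. The predicate \<^const>\<open>evenperm\<close> is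
  meaningful only for products of finitely many transpositions, which is what \<^const>\<open>permutation\<close>
  expresses.
\<close>

definition even_permutation_of :: "'a set \<Rightarrow> ('a \<rightharpoonup> 'a) \<Rightarrow> bool" where
  "even_permutation_of D \<gamma> \<longleftrightarrow>
     (\<exists>p. p permutes D \<and> permutation p \<and> evenperm p \<and> \<gamma> = (\<lambda>x. Some (p x)) |` D)"


section \<open>The congruences\<close>

definition ideal_I :: "'a set \<Rightarrow> nat \<Rightarrow> ('a \<rightharpoonup> 'a) set" where
  "ideal_I A n = {\<alpha> \<in> carrier (I_inf A). n \<le> card (A - dom \<alpha>)}"

definition K_I :: "'a set \<Rightarrow> nat \<Rightarrow> ('a \<rightharpoonup> 'a) rel" where
  "K_I A n = (ideal_I A n \<times> ideal_I A n) \<union> Delta (I_inf A)"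

definition K_S :: "'a set \<Rightarrow> nat \<Rightarrow> ('a \<rightharpoonup> 'a) rel" where
  "K_S A n =
     {(\<alpha>, \<beta>). (\<alpha>, \<beta>) \<in> green_H (I_inf A) \<and>
               card (A - dom \<alpha>) = n \<and> card (A - dom \<beta>) = n}
     \<union> (ideal_I A (n + 1) \<times> ideal_I A (n + 1)) \<union> Delta (I_inf A)"

definition K_A :: "'a set \<Rightarrow> nat \<Rightarrow> ('a \<rightharpoonup> 'a) rel" where
  "K_A A n =
     {(\<alpha>, \<beta>). (\<alpha>, \<beta>) \<in> green_H (I_inf A) \<and>
               even_permutation_of (dom \<alpha>) (\<alpha> \<otimes>\<^bsub>I_inf A\<^esub> pinv \<beta>) \<and>
               card (A - dom \<alpha>) = n \<and> card (A - dom \<beta>) = n}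
     \<union> (ideal_I A (n + 1) \<times> ideal_I A (n + 1)) \<union> Delta (I_inf A)"

end

theory Submission
  imports Defs
begin

text \<open>
  Every element is the restriction of a finitary permutation of \<open>\<lambda>\<close> to a cofinite set, and the size
  of the complement of its domain (its level) never decreases under multiplication. Let \<open>r\<close> be a
  congruence and \<open>n\<close> the least level of an element in a nontrivial class. If \<open>\<alpha> r \<beta>\<close> and
  \<open>D = dom \<alpha>\<close> is not contained in \<open>dom \<beta>\<close>, then multiplication by the idempotent on \<open>dom \<beta>\<close> and by
  a permutation undoing \<open>\<alpha>\<close> relates the idempotents on \<open>D\<close> and \<open>D \<inter> dom \<beta>\<close>. Conjugating, any point may
  be removed from any domain of that level or above, so \<open>r\<close> identifies all elements of these levels.
  Cutting down a related pair of distinct elements of level \<open>n\<close> gives this at level \<open>n + 1\<close>; the same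
  happens at level \<open>n\<close> itself as soon as some related pair is not \<open>H\<close>-related. Otherwise \<open>r\<close> at
  level \<open>n\<close> is described by a nontrivial normal subgroup of the finitary symmetric group of an
  infinite set, which is the alternating or the whole group.
\<close>

section \<open>Finitary permutations\<close>

abbreviation inv' :: "('a \<Rightarrow> 'b) \<Rightarrow> 'b \<Rightarrow> 'a" where
  "inv' f \<equiv> Hilbert_Choice.inv f"

text \<open>The finitary symmetric group of \<open>A\<close>: \<open>permutation\<close> asks for a
  finite product of transpositions, so parity makes sense although \<open>A\<close> may be
  infinite.\<close>

definition fin_perm :: "'a set \<Rightarrow> ('a \<Rightarrow> 'a) \<Rightarrow> bool" where
  "fin_perm A p \<longleftrightarrow> p permutes A \<and> permutation p"

lemma fin_perm_permutes: "fin_perm A p \<Longrightarrow> p permutes A"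
  by (simp add: fin_perm_def)

lemma fin_perm_id [simp]: "fin_perm A id"
  by (simp add: fin_perm_def)

lemma fin_perm_comp: "fin_perm A p \<Longrightarrow> fin_perm A q \<Longrightarrow> fin_perm A (p \<circ> q)"
  by (simp add: fin_perm_def permutes_compose permutation_compose)

lemma fin_perm_inv: "fin_perm A p \<Longrightarrow> fin_perm A (inv' p)"
  by (simp add: fin_perm_def permutes_inv permutation_inverse)

lemma fin_perm_mono: "fin_perm A p \<Longrightarrow> A \<subseteq> B \<Longrightarrow> fin_perm B p"
  unfolding fin_perm_def using permutes_subset by blast

lemma fin_perm_transpose: "a \<in> A \<Longrightarrow> b \<in> A \<Longrightarrow> fin_perm A (transpose a b)"
  by (simp add: fin_perm_def permutes_swap_id permutation_swap_id)

lemma fin_perm_finite: "finite F \<Longrightarrow> p permutes F \<Longrightarrow> F \<subseteq> A \<Longrightarrow> fin_perm A p"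
  unfolding fin_perm_def using permutation_permutes permutes_subset by blast

lemma fin_perm_finite_support: "fin_perm A p \<Longrightarrow> finite {x. p x \<noteq> x}"
  unfolding fin_perm_def using permutation_finite_support by blast

lemma fin_perm_inverses:
  assumes "fin_perm A p"
  shows "p (inv' p x) = x" "inv' p (p x) = x"
    and "p \<circ> inv' p = id" "inv' p \<circ> p = id" "inv' (inv' p) = p"
  using permutes_inverses[OF fin_perm_permutes[OF assms]]
    permutes_inv_o[OF fin_perm_permutes[OF assms]]
    permutes_inv_inv[OF fin_perm_permutes[OF assms]] by auto

lemma fin_perm_in: "fin_perm A p \<Longrightarrow> p x \<in> A \<longleftrightarrow> x \<in> A"
  unfolding fin_perm_def using permutes_in_image by metis

lemma fin_perm_eq_iff: "fin_perm A p \<Longrightarrow> p x = p y \<longleftrightarrow> x = y"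
  unfolding fin_perm_def using permutes_inj inj_eq by metis

lemma fin_perm_inj_on: "fin_perm A p \<Longrightarrow> inj_on p B"
  by (rule inj_onI) (simp add: fin_perm_eq_iff)

lemma evenperm_fin_perm_comp:
  "fin_perm A p \<Longrightarrow> fin_perm B q \<Longrightarrow> evenperm (p \<circ> q) \<longleftrightarrow> evenperm p = evenperm q"
  by (simp add: fin_perm_def evenperm_comp)

lemma evenperm_fin_perm_inv: "fin_perm A p \<Longrightarrow> evenperm (inv' p) = evenperm p"
  by (simp add: fin_perm_def evenperm_inv)

lemma evenperm_conj:
  assumes "fin_perm A p" "fin_perm B s"
  shows "evenperm (inv' s \<circ> p \<circ> s) = evenperm p"
  using assms by (auto simp: fin_perm_def evenperm_comp evenperm_inv permutation_compose permutation_inverse)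

text \<open>\<open>s\<close> carries \<open>D'\<close> onto \<open>D\<close>, so conjugation by
  \<open>s\<close> turns permutations of \<open>D\<close> into permutations of
  \<open>D'\<close>.\<close>

lemma fin_perm_conj:
  assumes p: "fin_perm D p" and s: "fin_perm A s" and D: "\<And>x. s x \<in> D \<longleftrightarrow> x \<in> D'"
  shows "fin_perm D' (inv' s \<circ> p \<circ> s)"
proof -
  have "bij (inv' s \<circ> p \<circ> s)"
    using p s by (meson bij_comp fin_perm_inv fin_perm_permutes permutes_bij)
  moreover have "inv' s (p (s x)) = x" if "x \<notin> D'" for x
    using p s that D by (metis fin_perm_inverses(2) fin_perm_permutes permutes_not_in)
  moreover have "permutation (inv' s \<circ> p \<circ> s)"
    using p s by (simp add: fin_perm_def permutation_compose permutation_inverse)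
  ultimately show ?thesis
    unfolding fin_perm_def permutes_def bij_iff by simp
qed

text \<open>\<open>G\<close> and its image have complements in \<open>F\<close> of the same size,
  and any bijection between these completes \<open>f\<close>. Permutations with finitely many
  prescribed values come from here.\<close>

lemma partial_injection_extends:
  assumes F: "finite F" "G \<subseteq> F" and f: "inj_on f G" "f ` G \<subseteq> F"
  obtains p where "p permutes F" "\<And>x. x \<in> G \<Longrightarrow> p x = f x"
proof -
  have fin: "finite G" using F finite_subset by blast
  have "card (F - G) = card (F - f ` G)"
    using F f fin by (simp add: card_Diff_subset card_image)
  then obtain h where h: "bij_betw h (F - G) (F - f ` G)"
    using finite_same_card_bij F(1) by (metis finite_Diff)
  define p where "p = (\<lambda>x. if x \<in> G then f x else if x \<in> F then h x else x)"
  have "bij_betw p G (f ` G)"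
    using f(1) by (simp add: bij_betw_def p_def cong: inj_on_cong)
  moreover have "bij_betw p (F - G) (F - f ` G)"
    using h by (rule bij_betw_cong[THEN iffD1, rotated]) (auto simp: p_def)
  ultimately have "bij_betw p (G \<union> (F - G)) (f ` G \<union> (F - f ` G))"
    by (rule bij_betw_combine) auto
  moreover have "G \<union> (F - G) = F" "f ` G \<union> (F - f ` G) = F" using F f by auto
  ultimately have "p permutes F" using F(2) by (intro bij_imp_permutes) (auto simp: p_def)
  moreover have "p x = f x" if "x \<in> G" for x using that by (simp add: p_def)
  ultimately show thesis using that by blast
qed

lemma conj_transpose:
  assumes "fin_perm A s"
  shows "s \<circ> transpose a b \<circ> inv' s = transpose (s a) (s b)"
proof
  fix x
  have "s (transpose a b (inv' s (s y))) = transpose (s a) (s b) (s y)" for y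
    by (simp add: transpose_def fin_perm_eq_iff[OF assms] fin_perm_inverses[OF assms])
  from this[of "inv' s x"] show "(s \<circ> transpose a b \<circ> inv' s) x = transpose (s a) (s b) x"
    by (simp add: fin_perm_inverses[OF assms])
qed

text \<open>
  The commutator of a non-identity permutation with a suitable transposition is a 3-cycle, so a
  nontrivial normal subgroup contains all 3-cycles.
\<close>

lemma normal_contains_evenperm:
  assumes D: "infinite D"
    and comp: "\<And>p q. p \<in> N \<Longrightarrow> q \<in> N \<Longrightarrow> p \<circ> q \<in> N"
    and invs: "\<And>p. p \<in> N \<Longrightarrow> inv' p \<in> N"
    and conj: "\<And>p s. p \<in> N \<Longrightarrow> fin_perm D s \<Longrightarrow> s \<circ> p \<circ> inv' s \<in> N"
    and p: "p \<in> N" "fin_perm D p" "p \<noteq> id"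
    and q: "fin_perm D q" "evenperm q"
  shows "q \<in> N"
proof -
  note p' = fin_perm_inverses[OF p(2)]
  obtain x where x: "p x \<noteq> x" using p(3) by (auto simp: fun_eq_iff)
  have xD: "x \<in> D" using x p(2) by (metis fin_perm_permutes permutes_not_in)
  have "finite ({x. p x \<noteq> x} \<union> {x, p x})" using fin_perm_finite_support[OF p(2)] by simp
  then have "D - ({x. p x \<noteq> x} \<union> {x, p x}) \<noteq> {}"
    using D by (metis Diff_infinite_finite finite.emptyI)
  then obtain z where z: "z \<in> D" "p z = z" "z \<noteq> x" "z \<noteq> p x" by blast
  define y where "y = p x"
  have yD: "y \<in> D" using xD fin_perm_in[OF p(2)] by (simp add: y_def)
  have t: "fin_perm D (transpose x z)" using xD z by (simp add: fin_perm_transpose)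
  have idN: "id \<in> N" using comp[OF p(1) invs[OF p(1)]] p' by simp
  \<comment> \<open>Since \<open>p\<close> fixes \<open>z\<close>, it conjugates the transposition
    of \<open>x\<close> and \<open>z\<close> to that of \<open>y\<close> and \<open>z\<close>; the
    commutator is therefore the product of these two, a 3-cycle.\<close>
  have "p \<circ> (transpose x z \<circ> inv' p \<circ> inv' (transpose x z)) \<in> N"
    by (intro comp conj invs p t)
  also have "p \<circ> (transpose x z \<circ> inv' p \<circ> inv' (transpose x z)) = transpose y z \<circ> transpose x z"
    using conj_transpose[OF p(2), of x z] z by (simp add: y_def o_assoc)
  finally have c: "transpose y z \<circ> transpose x z \<in> N" .
  have cyc: "transpose a b \<circ> transpose c b \<in> N"
    if "a \<in> D" "b \<in> D" "c \<in> D" "a \<noteq> b" "a \<noteq> c" "b \<noteq> c" for a b c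
  proof -
    define f where "f = (\<lambda>u. if u = y then a else if u = z then b else c)"
    have "finite {x,y,z,a,b,c}" "{x,y,z} \<subseteq> {x,y,z,a,b,c}" "f ` {x,y,z} \<subseteq> {x,y,z,a,b,c}"
      by (auto simp: f_def)
    moreover have "inj_on f {x,y,z}"
      using that by (auto simp: inj_on_def f_def)
    ultimately obtain s where s: "s permutes {x,y,z,a,b,c}" "\<And>u. u \<in> {x,y,z} \<Longrightarrow> s u = f u"
      using partial_injection_extends by metis
    have sD: "fin_perm D s" by (rule fin_perm_finite[OF _ s(1)]) (use xD yD z that in auto)
    have sv: "s y = a" "s z = b" "s x = c" using s(2) z x by (auto simp: f_def y_def)
    have "s \<circ> (transpose y z \<circ> transpose x z) \<circ> inv' s
      = (s \<circ> transpose y z \<circ> inv' s) \<circ> (s \<circ> transpose x z \<circ> inv' s)"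
      by (simp add: fun_eq_iff fin_perm_inverses[OF sD])
    also have "\<dots> = transpose a b \<circ> transpose c b"
      by (simp add: conj_transpose[OF sD] sv)
    finally show ?thesis using conj[OF c sD] by simp
  qed
  have two: "transpose a b \<circ> transpose c d \<in> N"
    if "a \<in> D" "b \<in> D" "c \<in> D" "d \<in> D" "a \<noteq> b" "c \<noteq> d" for a b c d
  proof -
    consider "a = c" "b = d" | "a = d" "b = c" | "b = d" "a \<noteq> c" | "a = c" "b \<noteq> d" | "a = d" "b \<noteq> c"
      | "b = c" "a \<noteq> d" | "a \<noteq> c" "a \<noteq> d" "b \<noteq> c" "b \<noteq> d" by blast
    then show ?thesis
    proof cases
      case 7
      \<comment> \<open>Disjoint transpositions: inserting the transposition of \<open>b\<close> and
        \<open>c\<close> twice splits the product into two 3-cycles.\<close>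
      have "transpose a b \<circ> transpose c d =
        (transpose a b \<circ> transpose c b) \<circ> (transpose b c \<circ> transpose d c)"
        by (simp add: fun_eq_iff transpose_commute)
      then show ?thesis using comp cyc 7 that by metis
    qed (use that idN cyc in \<open>metis transpose_commute transpose_comp_involutory\<close>)+
  qed
  define F where "F = {x. q x \<noteq> x}"
  have F: "finite F" "F \<subseteq> D"
    using fin_perm_finite_support[OF q(1)] permutes_not_in[OF fin_perm_permutes[OF q(1)]]
    by (auto simp: F_def)
  have "q permutes F"
    by (rule permutes_superset[OF fin_perm_permutes[OF q(1)]]) (auto simp: F_def)
  \<comment> \<open>Each induction step composes with one transposition and flips the parity, so odd
    permutations need a claim of their own: one more transposition in front brings them into
    \<open>N\<close>.\<close>
  from this F(1) have "q permutes F \<and> (evenperm q \<longrightarrow> q \<in> N) \<and>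
    (\<not> evenperm q \<longrightarrow> (\<forall>a\<in>D. \<forall>b\<in>D. a \<noteq> b \<longrightarrow> transpose a b \<circ> q \<in> N))"
  proof (induction q rule: permutes_induct)
    case id
    then show ?case using idN permutes_id[of F] by (simp add: id_def)
  next
    case (swap a b p)
    have pp: "permutation p" using swap(4) F by (auto simp: permutation_permutes)
    have ev: "evenperm (transpose a b \<circ> p) \<longleftrightarrow> \<not> evenperm p"
      using swap(3) by (simp add: evenperm_comp permutation_swap_id pp evenperm_swap)
    have ab: "a \<in> D" "b \<in> D" using swap F by auto
    have "transpose c d \<circ> (transpose a b \<circ> p) \<in> N"
      if "evenperm p" "c \<in> D" "d \<in> D" "c \<noteq> d" for c d
      using comp[OF two[of c d a b], of p] that ab swap by (simp add: o_assoc)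
    then show ?case using ev ab swap permutes_compose permutes_swap_id by (metis (full_types))
  qed
  then show ?thesis using q by blast
qed

section \<open>Structure of the semigroup\<close>

text \<open>Normal form of the elements, which turns products, domains and ranges into computations
  with total functions. Different \<open>p\<close> may give the same map, since only the values on
  \<open>D\<close> count.\<close>

definition restr :: "('a \<Rightarrow> 'b) \<Rightarrow> 'a set \<Rightarrow> ('a \<rightharpoonup> 'b)" where
  "restr p D = (\<lambda>x. Some (p x)) |` D"

definition cofin :: "'a set \<Rightarrow> 'a set \<Rightarrow> bool" where
  "cofin A D \<longleftrightarrow> D \<subseteq> A \<and> finite (A - D)"

lemma cofin_self [simp]: "cofin A A"
  by (simp add: cofin_def)

lemma cofin_Int: "cofin A D \<Longrightarrow> cofin A E \<Longrightarrow> cofin A (D \<inter> E)"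
  by (auto simp: cofin_def Diff_Int)

lemma cofin_Diff: "cofin A D \<Longrightarrow> finite F \<Longrightarrow> cofin A (D - F)"
  unfolding cofin_def by (auto intro: finite_subset[of _ "(A - D) \<union> F"])

lemma cofin_vimage:
  assumes "fin_perm A p" "cofin A E"
  shows "cofin A (A \<inter> p -` E)" "card (A - A \<inter> p -` E) = card (A - E)"
proof -
  have "A - A \<inter> p -` E = inv' p ` (A - E)"
  proof (intro equalityI subsetI)
    fix x assume "x \<in> A - A \<inter> p -` E"
    then have "p x \<in> A - E" "x = inv' p (p x)"
      using fin_perm_in[OF assms(1)] fin_perm_inverses[OF assms(1)] by auto
    then show "x \<in> inv' p ` (A - E)" by (rule rev_image_eqI)
  qed (auto simp: fin_perm_in[OF fin_perm_inv[OF assms(1)]] fin_perm_inverses[OF assms(1)])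
  then show "cofin A (A \<inter> p -` E)" "card (A - A \<inter> p -` E) = card (A - E)"
    using assms(2) fin_perm_inj_on[OF fin_perm_inv[OF assms(1)]]
    by (auto simp: cofin_def card_image)
qed

lemma cofin_Int_vimage: "fin_perm A p \<Longrightarrow> cofin A D \<Longrightarrow> cofin A E \<Longrightarrow> cofin A (D \<inter> p -` E)"
  using cofin_Int[OF _ cofin_vimage(1), of A D p E]
  by (simp add: cofin_def Int_absorb2 Int_assoc[symmetric])

lemma cofin_eqI:
  assumes "cofin A D" "cofin A E" "D \<subseteq> E" "card (A - D) \<le> card (A - E)"
  shows "D = E"
proof -
  have "A - E = A - D" using assms by (intro card_seteq) (auto simp: cofin_def)
  then show ?thesis using assms by (auto simp: cofin_def)
qed

lemma restr_apply: "restr p D x = (if x \<in> D then Some (p x) else None)"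
  by (simp add: restr_def)

lemma dom_restr [simp]: "dom (restr p D) = D"
  by (auto simp: restr_apply split: if_splits)

lemma ran_restr [simp]: "ran (restr p D) = p ` D"
  by (auto simp: ran_def restr_apply)

lemma restr_eq_iff: "restr p D = restr q E \<longleftrightarrow> D = E \<and> (\<forall>x\<in>D. p x = q x)"
proof
  assume eq: "restr p D = restr q E"
  then have "D = E" by (metis dom_restr)
  moreover have "p x = q x" if "x \<in> D" for x
    using fun_cong[OF eq, of x] that \<open>D = E\<close> by (simp add: restr_apply)
  ultimately show "D = E \<and> (\<forall>x\<in>D. p x = q x)" by blast
qed (auto simp: restr_apply fun_eq_iff)

lemma map_comp_restr: "restr q E \<circ>\<^sub>m restr p D = restr (q \<circ> p) (D \<inter> p -` E)"
  by (auto simp: fun_eq_iff restr_apply map_comp_def)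

lemma I_inf_mult [simp]: "a \<otimes>\<^bsub>I_inf A\<^esub> b = b \<circ>\<^sub>m a"
  by (simp add: I_inf_def)

text \<open>
  A map that is almost everywhere the identity permutes a finite set up to finitely many missing
  points, so it is a restriction of a finitary permutation.
\<close>

lemma carrier_I_inf_iff:
  "\<alpha> \<in> carrier (I_inf A) \<longleftrightarrow> (\<exists>p D. fin_perm A p \<and> cofin A D \<and> \<alpha> = restr p D)"
proof
  assume "\<alpha> \<in> carrier (I_inf A)"
  then have a: "dom \<alpha> \<subseteq> A" "ran \<alpha> \<subseteq> A" "inj_on \<alpha> (dom \<alpha>)" "finite (A - dom \<alpha>)"
    "finite {x \<in> dom \<alpha>. \<alpha> x \<noteq> Some x}"
    by (auto simp: I_inf_def partial_injections_def almost_identity_def)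
  define F where "F = (A - dom \<alpha>) \<union> {x \<in> dom \<alpha>. \<alpha> x \<noteq> Some x}"
  define f where "f = (\<lambda>x. the (\<alpha> x))"
  have \<alpha>f: "\<alpha> x = Some (f x)" if "x \<in> dom \<alpha>" for x using that by (auto simp: f_def)
  have fA: "f x \<in> A" if "x \<in> dom \<alpha>" for x using a(2) \<alpha>f[OF that] by (auto intro: ranI)
  have inj: "x = y" if "x \<in> dom \<alpha>" "y \<in> dom \<alpha>" "f x = f y" for x y
    using inj_onD[OF a(3) _ that(1,2)] \<alpha>f that by simp
  \<comment> \<open>A value outside \<open>F\<close> would be a fixed point of \<alpha>, and
    injectivity would make it equal to \<open>x\<close>, which lies in \<open>F\<close>.\<close>
  have "f x \<in> F" if "x \<in> F \<inter> dom \<alpha>" for x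
  proof (rule ccontr)
    assume n: "f x \<notin> F"
    have "f x \<in> dom \<alpha>" "\<alpha> (f x) = Some (f x)" using n fA[of x] that by (auto simp: F_def)
    then have "f x = x" using inj[of "f x" x] \<alpha>f[of "f x"] that by simp
    then show False using n that by simp
  qed
  moreover have "inj_on f (F \<inter> dom \<alpha>)" using inj by (auto intro: inj_onI)
  moreover have "finite F" using a by (simp add: F_def)
  ultimately obtain p where p: "p permutes F" "\<And>x. x \<in> F \<inter> dom \<alpha> \<Longrightarrow> p x = f x"
    using partial_injection_extends[of F "F \<inter> dom \<alpha>" f] by (metis image_subsetI inf_le1)
  have "fin_perm A p"
    by (rule fin_perm_finite[OF \<open>finite F\<close> p(1)]) (use a(1) in \<open>auto simp: F_def\<close>)
  moreover have "\<alpha> x = restr p (dom \<alpha>) x" for x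
  proof (cases "x \<in> dom \<alpha>")
    case True
    then show ?thesis using p(2)[of x] \<alpha>f[of x] permutes_not_in[OF p(1), of x]
      by (cases "x \<in> F") (auto simp: restr_apply F_def)
  qed (auto simp: restr_apply)
  ultimately show "\<exists>p D. fin_perm A p \<and> cofin A D \<and> \<alpha> = restr p D"
    using a by (auto simp: cofin_def fun_eq_iff)
next
  assume "\<exists>p D. fin_perm A p \<and> cofin A D \<and> \<alpha> = restr p D"
  then obtain p D where p: "fin_perm A p" "cofin A D" "\<alpha> = restr p D" by blast
  have "inj_on (restr p D) D"
    by (rule inj_onI) (simp add: restr_apply fin_perm_eq_iff[OF p(1)])
  moreover have "finite {x \<in> D. restr p D x \<noteq> Some x}"
    by (rule finite_subset[OF _ fin_perm_finite_support[OF p(1)]]) (auto simp: restr_apply)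
  ultimately show "\<alpha> \<in> carrier (I_inf A)"
    using p fin_perm_in[OF p(1)]
    by (auto simp: I_inf_def partial_injections_def almost_identity_def cofin_def)
qed

lemma restr_in_carrier: "fin_perm A p \<Longrightarrow> cofin A D \<Longrightarrow> restr p D \<in> carrier (I_inf A)"
  using carrier_I_inf_iff by blast

lemma carrier_I_infE:
  assumes "\<alpha> \<in> carrier (I_inf A)"
  obtains p D where "fin_perm A p" "cofin A D" "\<alpha> = restr p D"
  using assms carrier_I_inf_iff by blast

lemma I_inf_closed:
  assumes "a \<in> carrier (I_inf A)" "b \<in> carrier (I_inf A)"
  shows "b \<circ>\<^sub>m a \<in> carrier (I_inf A)"
  using assms by (elim carrier_I_infE)
    (simp add: map_comp_restr restr_in_carrier fin_perm_comp cofin_Int_vimage)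

lemma cofin_dom: "a \<in> carrier (I_inf A) \<Longrightarrow> cofin A (dom a)"
  by (auto elim: carrier_I_infE)

section \<open>Principal ideals and Green's relation H\<close>

text \<open>Multiplying on the right can only shrink the domain. Conversely, with \<open>b\<close>
  cut from \<open>q\<close> and \<open>a\<close> from \<open>p\<close>, undoing \<open>q\<close> and
  then applying \<open>p\<close> solves the equation for the right factor.\<close>

lemma principal_right_ideal_I_inf:
  assumes "b \<in> carrier (I_inf A)"
  shows "principal_right_ideal (I_inf A) b = {a \<in> carrier (I_inf A). dom a \<subseteq> dom b}"
proof (intro equalityI subsetI)
  fix a assume "a \<in> principal_right_ideal (I_inf A) b"
  then show "a \<in> {a \<in> carrier (I_inf A). dom a \<subseteq> dom b}"
    using assms I_inf_closed
    by (auto simp: principal_right_ideal_def l_coset_def map_comp_def split: option.splits)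
next
  fix a assume a: "a \<in> {a \<in> carrier (I_inf A). dom a \<subseteq> dom b}"
  then obtain p D where p: "fin_perm A p" "cofin A D" "a = restr p D" by (auto elim: carrier_I_infE)
  obtain q E where q: "fin_perm A q" "cofin A E" "b = restr q E" using assms by (auto elim: carrier_I_infE)
  let ?c = "restr (p \<circ> inv' q) (A \<inter> inv' q -` D)"
  have "?c \<circ>\<^sub>m b = a"
    using a p q fin_perm_in[OF q(1)]
    by (auto simp: map_comp_restr restr_eq_iff fin_perm_inverses[OF q(1)] cofin_def)
  moreover have "?c \<in> carrier (I_inf A)"
    using p q by (intro restr_in_carrier fin_perm_comp cofin_vimage fin_perm_inv)
  ultimately show "a \<in> principal_right_ideal (I_inf A) b"
    by (auto simp: principal_right_ideal_def l_coset_def)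
qed

text \<open>Dually, the range can only shrink, and \<open>p\<close> followed by the inverse of
  \<open>q\<close> is the left factor.\<close>

lemma principal_left_ideal_I_inf:
  assumes "b \<in> carrier (I_inf A)"
  shows "principal_left_ideal (I_inf A) b = {a \<in> carrier (I_inf A). ran a \<subseteq> ran b}"
proof (intro equalityI subsetI)
  fix a assume "a \<in> principal_left_ideal (I_inf A) b"
  then show "a \<in> {a \<in> carrier (I_inf A). ran a \<subseteq> ran b}"
    using assms I_inf_closed
    by (auto simp: principal_left_ideal_def r_coset_def map_comp_def ran_def split: option.splits)
next
  fix a assume a: "a \<in> {a \<in> carrier (I_inf A). ran a \<subseteq> ran b}"
  then obtain p D where p: "fin_perm A p" "cofin A D" "a = restr p D" by (auto elim: carrier_I_infE)
  obtain q E where q: "fin_perm A q" "cofin A E" "b = restr q E" using assms by (auto elim: carrier_I_infE)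
  let ?c = "restr (inv' q \<circ> p) D"
  have "inv' q (p x) \<in> E" if "x \<in> D" for x
    using that a p(3) q(3) by (auto simp: image_subset_iff fin_perm_inverses[OF q(1)])
  then have "b \<circ>\<^sub>m ?c = a"
    using p q by (auto simp: map_comp_restr restr_eq_iff fin_perm_inverses[OF q(1)])
  moreover have "?c \<in> carrier (I_inf A)"
    using p q by (intro restr_in_carrier fin_perm_comp fin_perm_inv)
  ultimately show "a \<in> principal_left_ideal (I_inf A) b"
    by (auto simp: principal_left_ideal_def r_coset_def)
qed

lemma green_H_I_inf_iff:
  "(a, b) \<in> green_H (I_inf A) \<longleftrightarrow>
    a \<in> carrier (I_inf A) \<and> b \<in> carrier (I_inf A) \<and> dom a = dom b \<and> ran a = ran b"
proof -
  have eq: "{c \<in> C. f c \<subseteq> f a} = {c \<in> C. f c \<subseteq> f b} \<longleftrightarrow> f a = f b"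
    if "a \<in> C" "b \<in> C" for C and f :: "('a \<rightharpoonup> 'a) \<Rightarrow> 'a set"
    using that by blast
  show ?thesis
  proof (cases "a \<in> carrier (I_inf A) \<and> b \<in> carrier (I_inf A)")
    case True
    then show ?thesis
      using eq[of "carrier (I_inf A)" dom] eq[of "carrier (I_inf A)" ran]
      by (simp add: green_H_def green_R_def green_L_def principal_right_ideal_I_inf
          principal_left_ideal_I_inf conj_commute)
  qed (auto simp: green_H_def green_R_def)
qed

lemma dom_comp_perm: "fin_perm (dom a) p \<Longrightarrow> a = b \<circ> p \<Longrightarrow> dom b = dom a"
proof -
  assume p: "fin_perm (dom a) p" "a = b \<circ> p"
  have "x \<in> dom b \<longleftrightarrow> x \<in> dom a" for x
    using p(2) fin_perm_in[OF p(1)] fin_perm_inverses(1)[OF p(1)]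
    by (metis comp_apply domIff)
  then show "dom b = dom a" by blast
qed

text \<open>
  The product \<open>a \<cdot> b\<inverse>\<close> of the paper is the permutation \<open>p\<close> of \<open>dom a\<close> with \<open>a = b \<circ> p\<close>.
\<close>

lemma green_H_iff_perm:
  assumes "a \<in> carrier (I_inf A)" "b \<in> carrier (I_inf A)"
  shows "(a, b) \<in> green_H (I_inf A) \<longleftrightarrow> (\<exists>p. fin_perm (dom a) p \<and> a = b \<circ> p)"
proof
  assume H: "(a, b) \<in> green_H (I_inf A)"
  obtain p D where p: "fin_perm A p" "cofin A D" "a = restr p D" using assms by (auto elim: carrier_I_infE)
  obtain q E where q: "fin_perm A q" "cofin A E" "b = restr q E" using assms by (auto elim: carrier_I_infE)
  have E: "E = D" "p ` D = q ` D" using H p q by (auto simp: green_H_I_inf_iff)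
  \<comment> \<open>Equal ranges make this composite a bijection of \<open>D\<close>;
    \<open>restrict_id\<close> replaces it by the identity elsewhere.\<close>
  define t where "t = restrict_id (inv' q \<circ> p) D"
  have "(inv' q \<circ> p) ` D = inv' q ` q ` D"
    using E(2) by (metis image_comp)
  also have "\<dots> = D" by (simp add: image_image fin_perm_inverses[OF q(1)])
  finally have "bij_betw (inv' q \<circ> p) D D"
    using fin_perm_inj_on[OF fin_perm_comp[OF fin_perm_inv[OF q(1)] p(1)]] by (simp add: bij_betw_def)
  then have t: "t permutes D" unfolding t_def by (rule permutes_restrict_id)
  have "finite {x. (inv' q \<circ> p) x \<noteq> x}"
    by (rule fin_perm_finite_support[OF fin_perm_comp[OF fin_perm_inv[OF q(1)] p(1)]])
  then have "finite {x. t x \<noteq> x}"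
    by (rule rev_finite_subset) (auto simp: t_def restrict_id_def)
  then have "fin_perm D t"
    using t by (simp add: fin_perm_def permutation permutes_bij)
  moreover have "a = b \<circ> t"
    using permutes_in_image[OF t] by (auto simp: fun_eq_iff p(3) q(3) E restr_apply)
      (auto simp: t_def fin_perm_inverses[OF q(1)])
  moreover have "dom a = D" using p(3) by simp
  ultimately show "\<exists>p. fin_perm (dom a) p \<and> a = b \<circ> p" by blast
next
  assume "\<exists>p. fin_perm (dom a) p \<and> a = b \<circ> p"
  then obtain p where p: "fin_perm (dom a) p" "a = b \<circ> p" by blast
  have "ran a = ran b"
    using p(2) fin_perm_inverses(1)[OF p(1)] unfolding ran_def by (metis comp_apply)
  then show "(a, b) \<in> green_H (I_inf A)"
    using assms dom_comp_perm[OF p] by (simp add: green_H_I_inf_iff)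
qed

text \<open>For \<open>p\<close> permuting \<open>dom a\<close>, the product of \<open>a\<close>
  with the inverse of \<open>b\<close> is \<open>p\<close> exactly if
  \<open>a = b \<circ> p\<close>: on the domain by injectivity of \<open>b\<close>, and outside it
  both sides are undefined.\<close>

lemma even_permutation_of_iff:
  assumes "(a, b) \<in> green_H (I_inf A)"
  shows "even_permutation_of (dom a) (a \<otimes>\<^bsub>I_inf A\<^esub> pinv b) \<longleftrightarrow>
    (\<exists>p. fin_perm (dom a) p \<and> evenperm p \<and> a = b \<circ> p)"
proof -
  have d: "dom a = dom b" "ran a = ran b" "inj_on b (dom b)"
    using assms by (simp_all add: green_H_I_inf_iff) (simp add: I_inf_def partial_injections_def)
  have "pinv b \<circ>\<^sub>m a = (\<lambda>x. Some (p x)) |` dom a \<longleftrightarrow> a = b \<circ> p" if p: "p permutes dom a" for p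
  proof -
    have "(pinv b \<circ>\<^sub>m a) x = ((\<lambda>x. Some (p x)) |` dom a) x \<longleftrightarrow> a x = (b \<circ> p) x" for x
    proof (cases "x \<in> dom a")
      case True
      then obtain y where "a x = Some y" by blast
      then show ?thesis using True by (auto simp: map_comp_def pinv_eq_Some_iff[OF d(3)])
    next
      case False
      then have "a x = None" "b x = None" "p x = x"
        using d permutes_not_in[OF p] by (auto simp: domIff)
      then show ?thesis using False by (simp add: map_comp_def)
    qed
    then show ?thesis unfolding fun_eq_iff by simp
  qed
  then show ?thesis unfolding even_permutation_of_def fin_perm_def I_inf_mult by metis
qed

section \<open>The listed relations are congruences\<close>

lemma ideal_I_subset: "ideal_I A m \<subseteq> carrier (I_inf A)"
  by (auto simp: ideal_I_def)

text \<open>With \<open>a\<close> applied first, the product is undefined wherever \<open>a\<close>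
  is. With \<open>a\<close> applied second, its domain lies in the preimage of \<open>dom a\<close>
  under a permutation extending \<open>d\<close>, and preimages keep the level.\<close>

lemma card_codim_map_comp:
  assumes "a \<in> carrier (I_inf A)" "d \<in> carrier (I_inf A)"
  shows "card (A - dom a) \<le> card (A - dom (d \<circ>\<^sub>m a))"
    and "card (A - dom a) \<le> card (A - dom (a \<circ>\<^sub>m d))"
proof -
  have fin: "finite (A - dom (d \<circ>\<^sub>m a))" "finite (A - dom (a \<circ>\<^sub>m d))"
    using I_inf_closed[OF assms] I_inf_closed[OF assms(2,1)] cofin_dom by (auto simp: cofin_def)
  show "card (A - dom a) \<le> card (A - dom (d \<circ>\<^sub>m a))"
    by (rule card_mono[OF fin(1)]) (auto simp: map_comp_def)
  obtain s E where s: "fin_perm A s" "cofin A E" "d = restr s E" using assms(2) by (rule carrier_I_infE)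
  have "card (A - dom a) = card (A - A \<inter> s -` dom a)"
    using cofin_vimage(2)[OF s(1) cofin_dom[OF assms(1)]] by simp
  also have "\<dots> \<le> card (A - dom (a \<circ>\<^sub>m d))"
    by (rule card_mono[OF fin(2)])
      (use s in \<open>auto simp: map_comp_def restr_apply cofin_def split: if_splits\<close>)
  finally show "card (A - dom a) \<le> card (A - dom (a \<circ>\<^sub>m d))" .
qed

lemma ideal_I_map_comp:
  assumes "a \<in> ideal_I A m" "d \<in> carrier (I_inf A)"
  shows "d \<circ>\<^sub>m a \<in> ideal_I A m" "a \<circ>\<^sub>m d \<in> ideal_I A m"
  using assms card_codim_map_comp[of a A d] I_inf_closed[of a A d] I_inf_closed[of d A a]
  by (auto simp: ideal_I_def)

text \<open>Common shape of the three families. Since \<open>T\<close> lives outside the ideal,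
  pairs of \<open>T\<close> and pairs of the ideal never chain, so transitivity can be checked
  separately. A product of a pair in \<open>T\<close> may fall into the ideal, provided both members
  do.\<close>

lemma congruence_on_ideal_union:
  fixes T :: "('a \<rightharpoonup> 'a) rel"
  assumes T: "T \<subseteq> (carrier (I_inf A) - ideal_I A m) \<times> (carrier (I_inf A) - ideal_I A m)"
    and "sym T" "trans T"
    and comp: "\<And>a b d. (a, b) \<in> T \<Longrightarrow> d \<in> carrier (I_inf A) \<Longrightarrow>
        (d \<circ>\<^sub>m a, d \<circ>\<^sub>m b) \<in> T \<union> ideal_I A m \<times> ideal_I A m \<and>
        (a \<circ>\<^sub>m d, b \<circ>\<^sub>m d) \<in> T \<union> ideal_I A m \<times> ideal_I A m"
  shows "congruence_on (I_inf A) (T \<union> ideal_I A m \<times> ideal_I A m \<union> Delta (I_inf A))"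
    (is "congruence_on _ ?r")
proof -
  have "equiv (carrier (I_inf A)) ?r"
  proof (rule equivI)
    show "?r \<subseteq> carrier (I_inf A) \<times> carrier (I_inf A)"
      using T ideal_I_subset by (auto simp: Delta_def)
    show "refl_on (carrier (I_inf A)) ?r" by (auto simp: refl_on_def Delta_def)
    show "sym ?r" using \<open>sym T\<close> by (auto simp: sym_def Delta_def)
    show "trans ?r"
    proof (rule transI)
      fix a b c assume "(a, b) \<in> ?r" "(b, c) \<in> ?r"
      then show "(a, c) \<in> ?r"
        using T transD[OF \<open>trans T\<close>, of a b c] by (auto simp: Delta_def)
    qed
  qed
  moreover have "(c \<otimes>\<^bsub>I_inf A\<^esub> a, c \<otimes>\<^bsub>I_inf A\<^esub> b) \<in> ?r \<and> (a \<otimes>\<^bsub>I_inf A\<^esub> c, b \<otimes>\<^bsub>I_inf A\<^esub> c) \<in> ?r"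
    if ab: "(a, b) \<in> ?r" and c: "c \<in> carrier (I_inf A)" for a b c
  proof -
    consider "(a, b) \<in> T" | "a \<in> ideal_I A m" "b \<in> ideal_I A m" | "a = b" "a \<in> carrier (I_inf A)"
      using ab by (auto simp: Delta_def)
    then show ?thesis
    proof cases
      case 1
      then show ?thesis using comp[OF 1 c] by auto
    next
      case 2
      then show ?thesis using c ideal_I_map_comp by auto
    next
      case 3
      then show ?thesis using c I_inf_closed by (auto simp: Delta_def)
    qed
  qed
  ultimately show ?thesis unfolding congruence_on_def by blast
qed

section \<open>Pairs on one level that differ by a permutation of the domain\<close>

text \<open>The level \<open>n\<close> part of \<open>K_S\<close> for \<open>odd_ok\<close> true and
  of \<open>K_A\<close> for \<open>odd_ok\<close> false, so that both families are treated at once.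
  The equation \<open>a = b \<circ> p\<close> also forces \<open>b\<close> to have the domain of
  \<open>a\<close>.\<close>

definition twist :: "bool \<Rightarrow> 'a set \<Rightarrow> nat \<Rightarrow> ('a \<rightharpoonup> 'a) rel" where
  "twist odd_ok A n = {(a, b). a \<in> carrier (I_inf A) \<and> b \<in> carrier (I_inf A) \<and> card (A - dom a) = n \<and>
     (\<exists>p. fin_perm (dom a) p \<and> (odd_ok \<or> evenperm p) \<and> a = b \<circ> p)}"

lemma twistE:
  assumes "(a, b) \<in> twist odd_ok A n"
  obtains p where "a \<in> carrier (I_inf A)" "b \<in> carrier (I_inf A)" "card (A - dom a) = n"
    "dom b = dom a" "fin_perm (dom a) p" "odd_ok \<or> evenperm p" "a = b \<circ> p"
  using assms dom_comp_perm unfolding twist_def by blast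

lemma sym_twist: "sym (twist odd_ok A n)"
proof (rule symI)
  fix a b assume "(a, b) \<in> twist odd_ok A n"
  then show "(b, a) \<in> twist odd_ok A n"
  proof (rule twistE)
    fix p assume h: "a \<in> carrier (I_inf A)" "b \<in> carrier (I_inf A)" "card (A - dom a) = n"
      "dom b = dom a" "fin_perm (dom a) p" "odd_ok \<or> evenperm p" "a = b \<circ> p"
    have "b = a \<circ> inv' p" by (simp add: h(7) o_assoc[symmetric] fin_perm_inverses[OF h(5)])
    moreover have "fin_perm (dom a) (inv' p)" "odd_ok \<or> evenperm (inv' p)"
      using h(6) fin_perm_inv[OF h(5)] evenperm_fin_perm_inv[OF h(5)] by simp_all
    ultimately show ?thesis using h(1-4) unfolding twist_def by auto
  qed
qed

lemma trans_twist: "trans (twist odd_ok A n)"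
proof (rule transI)
  fix a b c assume ab: "(a, b) \<in> twist odd_ok A n" and bc: "(b, c) \<in> twist odd_ok A n"
  from ab obtain p where p: "a \<in> carrier (I_inf A)" "card (A - dom a) = n"
    "dom b = dom a" "fin_perm (dom a) p" "odd_ok \<or> evenperm p" "a = b \<circ> p" by (rule twistE)
  from bc obtain q where q: "c \<in> carrier (I_inf A)" "fin_perm (dom b) q" "odd_ok \<or> evenperm q" "b = c \<circ> q"
    by (rule twistE)
  have "fin_perm (dom a) (q \<circ> p)" using p q by (simp add: fin_perm_comp)
  moreover have "odd_ok \<or> evenperm (q \<circ> p)"
    using p(5) q(3) evenperm_fin_perm_comp[OF q(2) p(4)] by auto
  moreover have "a = c \<circ> (q \<circ> p)" using p(6) q(4) by (simp add: o_assoc)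
  ultimately show "(a, c) \<in> twist odd_ok A n" using p q unfolding twist_def by blast
qed

text \<open>\<open>p\<close> acts first, so the same \<open>p\<close> relates the two products.
  Their domains correspond under \<open>p\<close> and have equal level: either the level is still
  \<open>n\<close> and the domain is unchanged, or both products are in the next ideal.\<close>

lemma twist_map_comp_right:
  assumes "(a, b) \<in> twist odd_ok A n" and d: "d \<in> carrier (I_inf A)"
  shows "(d \<circ>\<^sub>m a, d \<circ>\<^sub>m b) \<in> twist odd_ok A n \<union> ideal_I A (n + 1) \<times> ideal_I A (n + 1)"
proof -
  from assms(1) obtain p where p: "a \<in> carrier (I_inf A)" "b \<in> carrier (I_inf A)" "card (A - dom a) = n"
    "dom b = dom a" "fin_perm (dom a) p" "odd_ok \<or> evenperm p" "a = b \<circ> p" by (rule twistE)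
  have eq: "d \<circ>\<^sub>m a = (d \<circ>\<^sub>m b) \<circ> p" by (simp add: p(7) fun_eq_iff map_comp_def)
  have C: "d \<circ>\<^sub>m a \<in> carrier (I_inf A)" "d \<circ>\<^sub>m b \<in> carrier (I_inf A)"
    using p d I_inf_closed by auto
  have pA: "fin_perm A p" using p(5) cofin_dom[OF p(1)] fin_perm_mono by (auto simp: cofin_def)
  have "dom (d \<circ>\<^sub>m a) = A \<inter> p -` dom (d \<circ>\<^sub>m b)"
    using eq cofin_dom[OF C(1)] by (auto simp: cofin_def dom_def)
  then have card: "card (A - dom (d \<circ>\<^sub>m a)) = card (A - dom (d \<circ>\<^sub>m b))"
    using cofin_vimage(2)[OF pA cofin_dom[OF C(2)]] by simp
  show ?thesis
  proof (cases "card (A - dom (d \<circ>\<^sub>m a)) = n")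
    case True
    have "dom (d \<circ>\<^sub>m a) = dom a"
      using True p by (intro cofin_eqI[where A = A] cofin_dom C) (auto simp: map_comp_def)
    then show ?thesis using True C eq p unfolding twist_def by auto
  next
    case False
    then show ?thesis using card C card_codim_map_comp(1)[OF p(1) d] p(3) by (auto simp: ideal_I_def)
  qed
qed

text \<open>Applying \<open>d\<close> first conjugates \<open>p\<close> by the permutation
  \<open>s\<close> extending \<open>d\<close>, which preserves parity.\<close>

lemma twist_map_comp_left:
  assumes "(a, b) \<in> twist odd_ok A n" and d: "d \<in> carrier (I_inf A)"
  shows "(a \<circ>\<^sub>m d, b \<circ>\<^sub>m d) \<in> twist odd_ok A n \<union> ideal_I A (n + 1) \<times> ideal_I A (n + 1)"
proof -
  from assms(1) obtain p where p: "a \<in> carrier (I_inf A)" "b \<in> carrier (I_inf A)" "card (A - dom a) = n"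
    "dom b = dom a" "fin_perm (dom a) p" "odd_ok \<or> evenperm p" "a = b \<circ> p" by (rule twistE)
  obtain s E where s: "fin_perm A s" "cofin A E" "d = restr s E" using d by (rule carrier_I_infE)
  have C: "a \<circ>\<^sub>m d \<in> carrier (I_inf A)" "b \<circ>\<^sub>m d \<in> carrier (I_inf A)"
    using p d I_inf_closed by auto
  have da: "dom (a \<circ>\<^sub>m d) = E \<inter> s -` dom a"
    by (auto simp: s(3) map_comp_def restr_apply split: if_splits)
  have db: "dom (b \<circ>\<^sub>m d) = dom (a \<circ>\<^sub>m d)"
    unfolding da p(4)[symmetric] by (auto simp: s(3) map_comp_def restr_apply split: if_splits)
  show ?thesis
  proof (cases "card (A - dom (a \<circ>\<^sub>m d)) = n")
    case True
    \<comment> \<open>On level \<open>n\<close> nothing can be lost, so the domain is the whole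
      preimage of \<open>dom a\<close> under \<open>s\<close>; this makes the conjugate a
      permutation of it.\<close>
    have D: "dom (a \<circ>\<^sub>m d) = A \<inter> s -` dom a"
    proof (rule cofin_eqI[OF cofin_dom[OF C(1)] cofin_vimage(1)[OF s(1) cofin_dom[OF p(1)]]])
      show "dom (a \<circ>\<^sub>m d) \<subseteq> A \<inter> s -` dom a" using s(2) unfolding da cofin_def by blast
      show "card (A - dom (a \<circ>\<^sub>m d)) \<le> card (A - A \<inter> s -` dom a)"
        using True p(3) cofin_vimage(2)[OF s(1) cofin_dom[OF p(1)]] by simp
    qed
    define q where "q = inv' s \<circ> p \<circ> s"
    have q: "fin_perm (dom (a \<circ>\<^sub>m d)) q" unfolding q_def
      by (rule fin_perm_conj[OF p(5) s(1)])
        (use D cofin_dom[OF p(1)] fin_perm_in[OF s(1)] in \<open>auto simp: cofin_def\<close>)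
    have "(a \<circ>\<^sub>m d) x = (b \<circ>\<^sub>m d) (q x)" for x
    proof (cases "x \<in> dom (a \<circ>\<^sub>m d)")
      case True
      then have "x \<in> E" "q x \<in> E" using fin_perm_in[OF q, of x] da by auto
      then show ?thesis
        by (simp add: s(3) map_comp_def restr_apply p(7) q_def fin_perm_inverses[OF s(1)])
    next
      case False
      then have "q x = x" using permutes_not_in[OF fin_perm_permutes[OF q]] by blast
      then show ?thesis using False db by (metis domIff)
    qed
    moreover have "odd_ok \<or> evenperm q" using p(6) evenperm_conj[OF p(5) s(1)] by (simp add: q_def)
    ultimately show ?thesis using True C q unfolding twist_def by (auto simp: fun_eq_iff)
  next
    case False
    then show ?thesis using db C card_codim_map_comp(2)[OF p(1) d] p(3) by (auto simp: ideal_I_def)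
  qed
qed

lemma congruence_on_twist:
  "congruence_on (I_inf A)
    (twist odd_ok A n \<union> ideal_I A (n + 1) \<times> ideal_I A (n + 1) \<union> Delta (I_inf A))"
proof (rule congruence_on_ideal_union)
  show "twist odd_ok A n \<subseteq> (carrier (I_inf A) - ideal_I A (n + 1)) \<times> (carrier (I_inf A) - ideal_I A (n + 1))"
    by (auto elim!: twistE simp: ideal_I_def)
qed (simp_all only: sym_twist trans_twist twist_map_comp_left twist_map_comp_right simp_thms)

lemma K_S_eq_twist:
  "K_S A n = twist True A n \<union> ideal_I A (n + 1) \<times> ideal_I A (n + 1) \<union> Delta (I_inf A)"
proof -
  have "(a, b) \<in> green_H (I_inf A) \<and> card (A - dom a) = n \<and> card (A - dom b) = n
    \<longleftrightarrow> (a, b) \<in> twist True A n" for a b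
    using green_H_iff_perm[of a A b] green_H_I_inf_iff[of a b A] by (auto simp: twist_def)
  then show ?thesis unfolding K_S_def by simp
qed

lemma K_A_eq_twist:
  "K_A A n = twist False A n \<union> ideal_I A (n + 1) \<times> ideal_I A (n + 1) \<union> Delta (I_inf A)"
proof -
  have "(a, b) \<in> green_H (I_inf A) \<and> even_permutation_of (dom a) (a \<otimes>\<^bsub>I_inf A\<^esub> pinv b) \<and>
      card (A - dom a) = n \<and> card (A - dom b) = n
    \<longleftrightarrow> (a, b) \<in> twist False A n" (is "?l \<longleftrightarrow> ?r") for a b
  proof
    assume ?l
    then show ?r using even_permutation_of_iff[of a b A] green_H_I_inf_iff[of a b A]
      by (auto simp: twist_def)
  next
    assume ?r
    then have H: "(a, b) \<in> green_H (I_inf A)"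
      using green_H_iff_perm[of a A b] by (auto simp: twist_def)
    then show ?l using \<open>?r\<close> even_permutation_of_iff[OF H] green_H_I_inf_iff[of a b A]
      unfolding twist_def by auto
  qed
  then show ?thesis unfolding K_A_def by simp
qed

lemma congruence_on_K_S: "congruence_on (I_inf A) (K_S A n)"
  and congruence_on_K_A: "congruence_on (I_inf A) (K_A A n)"
  unfolding K_S_eq_twist K_A_eq_twist by (rule congruence_on_twist)+

lemma congruence_on_K_I: "congruence_on (I_inf A) (K_I A n)"
  using congruence_on_ideal_union[of "{}" A n] by (simp add: K_I_def sym_def)

lemma congruence_on_Delta: "congruence_on (I_inf A) (Delta (I_inf A))"
  using I_inf_closed[of _ A]
  by (auto simp: congruence_on_def Delta_def equiv_def refl_on_def sym_def trans_def)

text \<open>Every element has level at least 0, so the universal congruence is the case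
  \<open>n = 0\<close> of a family that is listed from 1 on.\<close>

lemma K_I_0: "K_I A 0 = Omega (I_inf A)"
  by (auto simp: K_I_def ideal_I_def Delta_def Omega_def)

section \<open>Classification of the congruences\<close>

text \<open>Complements of equal finite size are matched by a bijection, to which the assignment of
  \<open>x\<close> to \<open>x'\<close> is added; this finite partial injection extends to
  \<open>s\<close>. It serves to conjugate between any two domains of one level.\<close>

lemma cofin_transport:
  assumes D: "cofin A D" "cofin A D'" "card (A - D) = card (A - D')" and x: "x \<in> D" "x' \<in> D'"
  obtains s where "fin_perm A s" "s x' = x" "\<And>y. y \<in> A \<Longrightarrow> s y \<in> D \<longleftrightarrow> y \<in> D'"
proof -
  obtain h where h: "bij_betw h (A - D') (A - D)"
    using D finite_same_card_bij[of "A - D'" "A - D"] by (auto simp: cofin_def)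
  define F G where "F = (A - D) \<union> (A - D') \<union> {x, x'}" and "G = insert x' (A - D')"
  define f where "f = h(x' := x)"
  have f: "f ` (A - D') = A - D" "f x' = x"
    using h x by (auto simp: f_def bij_betw_def)
  have "inj_on f G"
    using h x D by (auto simp: G_def f_def bij_betw_def inj_on_def)
  moreover have "f ` G \<subseteq> F" using f by (auto simp: G_def F_def)
  moreover have "finite F" "G \<subseteq> F" using D by (auto simp: F_def G_def cofin_def)
  ultimately obtain s where s: "s permutes F" "\<And>y. y \<in> G \<Longrightarrow> s y = f y"
    using partial_injection_extends by metis
  have sA: "fin_perm A s"
    by (rule fin_perm_finite[OF \<open>finite F\<close> s(1)]) (use D x in \<open>auto simp: F_def cofin_def\<close>)
  have im: "s ` (A - D') = A - D" using f(1) s(2) by (auto simp: G_def image_iff)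
  have "s y \<in> D \<longleftrightarrow> y \<in> D'" if "y \<in> A" for y
  proof -
    have "s y \<in> A - D \<longleftrightarrow> y \<in> A - D'"
      unfolding im[symmetric] using fin_perm_eq_iff[OF sA] by auto
    then show ?thesis using that D fin_perm_in[OF sA, of y] by (auto simp: cofin_def)
  qed
  then show thesis using that[OF sA] s(2)[of x'] f(2) by (simp add: G_def)
qed

section \<open>Rules for an arbitrary congruence\<close>

locale I_inf_congruence =
  fixes A :: "'a set" and r :: "('a \<rightharpoonup> 'a) rel"
  assumes cong: "congruence_on (I_inf A) r"
begin

lemma equiv: "equiv (carrier (I_inf A)) r"
  using cong by (simp add: congruence_on_def)

lemma in_carrier: "(a, b) \<in> r \<Longrightarrow> a \<in> carrier (I_inf A)" "(a, b) \<in> r \<Longrightarrow> b \<in> carrier (I_inf A)"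
  using equiv by (auto simp: equiv_def)

lemma refl: "a \<in> carrier (I_inf A) \<Longrightarrow> (a, a) \<in> r"
  using equiv by (auto simp: equiv_def refl_on_def)

lemma sym: "(a, b) \<in> r \<Longrightarrow> (b, a) \<in> r"
  using equiv by (auto simp: equiv_def sym_def)

lemma trans: "(a, b) \<in> r \<Longrightarrow> (b, c) \<in> r \<Longrightarrow> (a, c) \<in> r"
  using equiv by (auto simp: equiv_def dest: transD)

lemma map_comp_right:
  assumes "(a, b) \<in> r" "d \<in> carrier (I_inf A)" shows "(d \<circ>\<^sub>m a, d \<circ>\<^sub>m b) \<in> r"
  using cong assms unfolding congruence_on_def I_inf_mult by blast

lemma map_comp_left:
  assumes "(a, b) \<in> r" "d \<in> carrier (I_inf A)" shows "(a \<circ>\<^sub>m d, b \<circ>\<^sub>m d) \<in> r"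
  using cong assms unfolding congruence_on_def I_inf_mult by blast

lemma restr_right:
  assumes "(restr p D, restr q E) \<in> r" "fin_perm A s" "cofin A C"
  shows "(restr (s \<circ> p) (D \<inter> p -` C), restr (s \<circ> q) (E \<inter> q -` C)) \<in> r"
  using map_comp_right[OF assms(1) restr_in_carrier[OF assms(2,3)]] by (simp add: map_comp_restr)

lemma restr_left:
  assumes "(restr p D, restr q E) \<in> r" "fin_perm A s" "cofin A C"
  shows "(restr (p \<circ> s) (C \<inter> s -` D), restr (q \<circ> s) (C \<inter> s -` E)) \<in> r"
  using map_comp_left[OF assms(1) restr_in_carrier[OF assms(2,3)]] by (simp add: map_comp_restr)

lemma restr_cofin: "(restr p D, restr q E) \<in> r \<Longrightarrow> cofin A D \<and> cofin A E"
  using in_carrier cofin_dom by fastforce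

lemma restr_right_perm:
  assumes "(restr p D, restr q E) \<in> r" "fin_perm A s" "fin_perm A p" "fin_perm A q"
  shows "(restr (s \<circ> p) D, restr (s \<circ> q) E) \<in> r"
proof -
  have "D \<inter> p -` A = D" "E \<inter> q -` A = E"
    using restr_cofin[OF assms(1)] fin_perm_in[OF assms(3)] fin_perm_in[OF assms(4)]
    by (auto simp: cofin_def)
  then show ?thesis using restr_right[OF assms(1,2) cofin_self] by simp
qed

text \<open>Restricting both maps to \<open>E\<close> leaves the second one unchanged, so it is
  related to \<open>p\<close> on \<open>D\<close> and to \<open>p\<close> on the intersection; then
  \<open>p\<close> is undone on the right.\<close>

lemma idem_Int:
  assumes "(restr p D, restr q E) \<in> r" "fin_perm A p"
  shows "(restr id D, restr id (D \<inter> E)) \<in> r"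
proof -
  have "(restr p (E \<inter> D), restr q E) \<in> r"
    using restr_left[OF assms(1) fin_perm_id, of E] restr_cofin[OF assms(1)] by simp
  then have "(restr p D, restr p (E \<inter> D)) \<in> r" using assms(1) sym trans by blast
  from restr_right_perm[OF this fin_perm_inv[OF assms(2)] assms(2) assms(2)]
  show ?thesis by (simp add: fin_perm_inverses[OF assms(2)] Int_commute)
qed

section \<open>From one removable point to the collapse of an ideal\<close>

context
  fixes D E x
  assumes D: "(restr id D, restr id E) \<in> r" "x \<in> D" "x \<notin> E"
begin

text \<open>\<open>D\<close> and \<open>D - {x}\<close> meet \<open>E\<close> in the same set, and
  the idempotents on both are related to the one on that set.\<close>

lemma idem_remove: "(restr id D, restr id (D - {x})) \<in> r"
proof -
  have c: "cofin A (D - {x})" using restr_cofin[OF D(1)] by (simp add: cofin_Diff)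
  have "(D - {x}) \<inter> E = D \<inter> E" using D by blast
  then have 1: "(restr id (D - {x}), restr id (D \<inter> E)) \<in> r"
    using restr_left[OF D(1) fin_perm_id c] D by (simp add: Int_absorb2 Diff_Int_distrib2)
  show ?thesis using idem_Int[OF D(1) fin_perm_id] 1 sym trans by blast
qed

text \<open>Enlarge \<open>D'\<close> to a domain \<open>D2\<close> on the level of
  \<open>D\<close>, carry the pair for \<open>D\<close> and \<open>x\<close> over to
  \<open>D2\<close> and \<open>x'\<close> by conjugation, and cut down to \<open>D'\<close>.\<close>

lemma idem_remove_any:
  assumes D': "cofin A D'" "card (A - D) \<le> card (A - D')" and x': "x' \<in> D'"
  shows "(restr id D', restr id (D' - {x'})) \<in> r"
proof -
  have fin: "finite (A - D')" and DA: "cofin A D" using D' restr_cofin[OF D(1)] by (auto simp: cofin_def)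
  obtain C where C: "C \<subseteq> A - D'" "card C = card (A - D)"
    using D'(2) by (meson obtain_subset_with_card_n)
  define D2 where "D2 = A - C"
  have D2: "cofin A D2" "A - D2 = C" "D' \<subseteq> D2"
  proof -
    show "A - D2 = C" using C(1) by (auto simp: D2_def)
    then show "cofin A D2" using finite_subset[OF C(1) fin] by (auto simp: D2_def cofin_def)
    show "D' \<subseteq> D2" using C(1) D' by (auto simp: D2_def cofin_def)
  qed
  obtain s where s: "fin_perm A s" "s x' = x" "\<And>y. y \<in> A \<Longrightarrow> s y \<in> D \<longleftrightarrow> y \<in> D2"
    using cofin_transport[OF DA D2(1) _ D(2), of x'] C D2 x' by auto
  have "D2 = A \<inter> s -` D" using s(3) D2 by (auto simp: cofin_def)
  moreover have "D2 - {x'} = A \<inter> s -` (D - {x})"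
    using s(3) D2 fin_perm_eq_iff[OF s(1), of _ x'] s(2) by (auto simp: cofin_def)
  ultimately have "(restr (id \<circ> s) D2, restr (id \<circ> s) (D2 - {x'})) \<in> r"
    using restr_left[OF idem_remove s(1) cofin_self] by simp
  from restr_right_perm[OF this fin_perm_inv[OF s(1)]]
  have "(restr id D2, restr id (D2 - {x'})) \<in> r"
    using s(1) by (simp add: fin_perm_inverses[OF s(1)])
  from restr_left[OF this fin_perm_id D'(1)]
  have "(restr id (D' \<inter> D2), restr id (D' \<inter> (D2 - {x'}))) \<in> r" by simp
  moreover have "D' \<inter> D2 = D'" "D' \<inter> (D2 - {x'}) = D' - {x'}" using D2(3) by auto
  ultimately show ?thesis by simp
qed

lemma idem_remove_finite:
  assumes "finite F" "cofin A D'" "card (A - D) \<le> card (A - D')"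
  shows "(restr id D', restr id (D' - F)) \<in> r"
  using assms(1)
proof induction
  case empty
  show ?case unfolding Diff_empty by (rule refl[OF restr_in_carrier[OF fin_perm_id assms(2)]])
next
  case (insert y F)
  have c: "cofin A (D' - F)" using assms insert cofin_Diff by blast
  have "card (A - D) \<le> card (A - (D' - F))"
    using assms(3) c by (elim order_trans, intro card_mono) (auto simp: cofin_def)
  then have "(restr id (D' - F), restr id (D' - F - {y})) \<in> r"
    using idem_remove_any[OF c] refl[OF restr_in_carrier[OF fin_perm_id c]]
    by (cases "y \<in> D' - F") simp_all
  moreover have "D' - F - {y} = D' - insert y F" by blast
  ultimately show ?case using insert.IH trans by metis
qed

text \<open>Removing the support of its permutation turns an element into an idempotent, so each
  element of the ideal is related to the idempotent on its own domain. Two idempotents are related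
  through their product.\<close>

lemma ideal_subset:
  assumes "card (A - D) \<le> m"
  shows "ideal_I A m \<times> ideal_I A m \<subseteq> r"
proof -
  have idem: "(a, restr id (dom a)) \<in> r" if "a \<in> ideal_I A m" for a
  proof -
    have "a \<in> carrier (I_inf A)" using that by (simp add: ideal_I_def)
    then obtain p C where p: "fin_perm A p" "cofin A C" "a = restr p C" by (rule carrier_I_infE)
    let ?F = "{x. p x \<noteq> x}"
    have 1: "(restr id C, restr id (C - ?F)) \<in> r"
      using that p assms
      by (intro idem_remove_finite fin_perm_finite_support[OF p(1)]) (auto simp: ideal_I_def)
    have "(restr p C, restr p (C - ?F)) \<in> r"
      using restr_right_perm[OF 1 p(1) fin_perm_id fin_perm_id] by simp
    moreover have "restr p (C - ?F) = restr id (C - ?F)" by (auto simp: restr_eq_iff)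
    ultimately have "(restr p C, restr id (C - ?F)) \<in> r" by simp
    then show ?thesis using trans[OF _ sym[OF 1]] p(3) by simp
  qed
  have meet: "(restr id (dom a), restr id (dom a \<inter> dom b)) \<in> r" if "a \<in> ideal_I A m" "b \<in> ideal_I A m" for a b
  proof -
    have c: "cofin A (dom a)" "cofin A (dom b)" using that cofin_dom ideal_I_subset by blast+
    have "dom a - (A - dom b) = dom a \<inter> dom b" using c by (auto simp: cofin_def)
    then show ?thesis
      using idem_remove_finite[of "A - dom b" "dom a"] that c assms by (auto simp: cofin_def ideal_I_def)
  qed
  have "(a, b) \<in> r" if "a \<in> ideal_I A m" "b \<in> ideal_I A m" for a b
  proof -
    have "(b, restr id (dom a \<inter> dom b)) \<in> r"
      using trans[OF idem meet] that by (metis Int_commute)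
    then show ?thesis using trans[OF trans[OF idem meet] sym] that by blast
  qed
  then show ?thesis by blast
qed

end

lemma ideal_subset_dom:
  assumes "(a, b) \<in> r" "\<not> dom a \<subseteq> dom b" "card (A - dom a) \<le> m"
  shows "ideal_I A m \<times> ideal_I A m \<subseteq> r"
proof -
  obtain p D where p: "fin_perm A p" "a = restr p D" using in_carrier(1)[OF assms(1)] by (auto elim: carrier_I_infE)
  obtain q E where q: "b = restr q E" using in_carrier(2)[OF assms(1)] by (auto elim: carrier_I_infE)
  obtain x where "x \<in> D" "x \<notin> E" using assms(2) p q by auto
  then show ?thesis using ideal_subset[OF idem_Int[of p D q E], of x m] assms p q by auto
qed

text \<open>Unequal domains collapse an ideal directly. For equal domains, deleting from the ranges
  the value of \<open>a\<close> at a point of disagreement makes the domains unequal, at the cost of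
  one level.\<close>

lemma ideal_subset_Suc:
  assumes "(a, b) \<in> r" "a \<noteq> b"
  shows "ideal_I A (card (A - dom a) + 1) \<times> ideal_I A (card (A - dom a) + 1) \<subseteq> r"
proof -
  have c: "cofin A (dom a)" "cofin A (dom b)" using in_carrier[OF assms(1)] cofin_dom by blast+
  consider "\<not> dom a \<subseteq> dom b" | "dom a \<subseteq> dom b" "\<not> dom b \<subseteq> dom a" | "dom a = dom b" by blast
  then show ?thesis
  proof cases
    case 1
    then show ?thesis using ideal_subset_dom[OF assms(1)] by simp
  next
    case 2
    have "card (A - dom b) \<le> card (A - dom a)"
      using c 2 by (intro card_mono) (auto simp: cofin_def)
    then show ?thesis using ideal_subset_dom[OF sym[OF assms(1)]] 2 by simp
  next
    case 3
    obtain p D where p: "fin_perm A p" "a = restr p D" using in_carrier(1)[OF assms(1)] by (auto elim: carrier_I_infE)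
    obtain q where q: "fin_perm A q" "b = restr q D"
      using in_carrier(2)[OF assms(1)] 3 p by (auto elim: carrier_I_infE)
    obtain x where x: "x \<in> D" "p x \<noteq> q x" using assms(2) p q by (auto simp: restr_eq_iff)
    let ?C = "A - {p x}"
    let ?D1 = "D \<inter> p -` ?C" and ?D2 = "D \<inter> q -` ?C"
    have D: "cofin A D" using c p by simp
    have xA: "x \<in> A" using D x by (auto simp: cofin_def)
    have "(restr p ?D1, restr q ?D2) \<in> r"
      using restr_right[of p D q D id ?C] assms(1) p q by (simp add: cofin_def Diff_Diff_Int)
    then have 2: "(restr q ?D2, restr p ?D1) \<in> r" by (rule sym)
    \<comment> \<open>Only the preimage of \<open>p x\<close> under \<open>q\<close> can leave the
      domain, hence the bound with \<open>+ 1\<close>.\<close>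
    have "A - ?D2 \<subseteq> insert (inv' q (p x)) (A - D)"
      using fin_perm_in[OF q(1)] fin_perm_inverses(2)[OF q(1)] by auto metis
    then have "card (A - ?D2) \<le> card (insert (inv' q (p x)) (A - D))"
      using D by (intro card_mono) (auto simp: cofin_def)
    also have "\<dots> \<le> card (A - D) + 1" by (simp add: card_insert_le_m1 card_insert_if)
    finally have "card (A - ?D2) \<le> card (A - D) + 1" .
    moreover have "\<not> ?D2 \<subseteq> ?D1"
      using x xA fin_perm_in[OF q(1), of x] by auto
    ultimately show ?thesis using ideal_subset_dom[OF 2] p by simp
  qed
qed

text \<open>Cutting the range down to that of \<open>b\<close> leaves \<open>b\<close> unchanged and
  shrinks \<open>a\<close>, so \<open>a\<close> is related to a proper restriction of
  itself.\<close>

lemma ideal_subset_ran: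
  assumes "(a, b) \<in> r" "dom a = dom b" "ran a \<noteq> ran b"
  shows "ideal_I A (card (A - dom a)) \<times> ideal_I A (card (A - dom a)) \<subseteq> r"
proof -
  obtain p D where p: "fin_perm A p" "a = restr p D" using in_carrier(1)[OF assms(1)] by (auto elim: carrier_I_infE)
  obtain q where q: "fin_perm A q" "b = restr q D"
    using in_carrier(2)[OF assms(1)] assms(2) p by (auto elim: carrier_I_infE)
  have D: "cofin A D" using cofin_dom in_carrier assms(1) p by fastforce
  have pD: "A - s ` D = s ` (A - D)" if s: "fin_perm A s" for s
    using image_set_diff[OF permutes_inj[OF fin_perm_permutes[OF s]], of A D]
    by (simp add: permutes_image[OF fin_perm_permutes[OF s]])
  have cof: "cofin A (s ` D)" "card (A - s ` D) = card (A - D)" if s: "fin_perm A s" for s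
    using D fin_perm_in[OF s] pD[OF s] fin_perm_inj_on[OF s] by (auto simp: cofin_def card_image)
  \<comment> \<open>Both ranges have the level of \<open>D\<close>, so unequal ranges are not
    nested.\<close>
  have "\<not> p ` D \<subseteq> q ` D"
    using cofin_eqI[OF cof(1)[OF p(1)] cof(1)[OF q(1)]] cof(2) p q assms(3) by auto
  moreover have "(restr (id \<circ> p) (D \<inter> p -` q ` D), restr (id \<circ> q) (D \<inter> q -` q ` D)) \<in> r"
    using assms(1) p q by (intro restr_right fin_perm_id cof) auto
  moreover have "D \<inter> q -` q ` D = D" by blast
  ultimately have "(restr p (D \<inter> p -` q ` D), b) \<in> r" "\<not> D \<subseteq> D \<inter> p -` q ` D"
    using q by auto
  then show ?thesis
    using ideal_subset_dom[OF trans[OF assms(1) sym]] p by (metis dom_restr order_refl)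
qed


section \<open>The normal subgroup attached to a domain\<close>

text \<open>Undoing \<open>b\<close> on the right reduces a pair to a permutation of the domain
  paired with the identity; \<open>twist_of_perm\<close> goes back by multiplying with
  \<open>b\<close>.\<close>

lemma perm_of_twist:
  assumes "(a, b) \<in> r" and p: "fin_perm (dom a) p" "a = b \<circ> p"
  shows "(restr p (dom a), restr id (dom a)) \<in> r"
proof -
  have C: "a \<in> carrier (I_inf A)" "b \<in> carrier (I_inf A)" using in_carrier[OF assms(1)] by auto
  obtain q E where q: "fin_perm A q" "cofin A E" "b = restr q E" using C(2) by (rule carrier_I_infE)
  have E: "E = dom a" using dom_comp_perm[OF p] q(3) by simp
  have pA: "fin_perm A p" using p(1) cofin_dom[OF C(1)] fin_perm_mono by (auto simp: cofin_def)
  have "a x = restr (q \<circ> p) (dom a) x" for x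
    using fin_perm_in[OF p(1), of x] fun_cong[OF p(2), of x] q(3) E by (simp add: restr_apply)
  then have "a = restr (q \<circ> p) (dom a)" by blast
  then have "(restr (q \<circ> p) (dom a), restr q (dom a)) \<in> r" using assms(1) q(3) E by simp
  from restr_right_perm[OF this fin_perm_inv[OF q(1)] fin_perm_comp[OF q(1) pA] q(1)]
  show ?thesis by (simp add: o_assoc fin_perm_inverses[OF q(1)])
qed

lemma twist_of_perm:
  assumes "(restr p (dom b), restr id (dom b)) \<in> r" "fin_perm (dom b) p" "b \<in> carrier (I_inf A)"
  shows "(b \<circ> p, b) \<in> r"
proof -
  have "b \<circ>\<^sub>m restr p (dom b) = b \<circ> p"
  proof
    fix x show "(b \<circ>\<^sub>m restr p (dom b)) x = (b \<circ> p) x"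
      using permutes_not_in[OF fin_perm_permutes[OF assms(2)], of x]
      by (cases "x \<in> dom b") (auto simp: map_comp_def restr_apply domIff)
  qed
  moreover have "b \<circ>\<^sub>m restr id (dom b) = b"
    by (auto simp: fun_eq_iff map_comp_def restr_apply domIff)
  ultimately show ?thesis using map_comp_right[OF assms(1,3)] by simp
qed

text \<open>For \<open>D' = D\<close> this is normality of the group of permutations related to the
  identity; in general it moves the group to another domain of the same level.\<close>

lemma perm_conj:
  assumes "(restr p D, restr id D) \<in> r" "fin_perm D p"
    and s: "fin_perm A s" "\<And>y. y \<in> A \<Longrightarrow> s y \<in> D \<longleftrightarrow> y \<in> D'" and D': "cofin A D'"
  shows "(restr (inv' s \<circ> p \<circ> s) D', restr id D') \<in> r"
proof -
  have D: "D' = A \<inter> s -` D" using s(2) D' by (auto simp: cofin_def)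
  have pA: "fin_perm A p"
    using fin_perm_mono[OF assms(2)] restr_cofin[OF assms(1)] by (simp add: cofin_def)
  have "(restr (p \<circ> s) D', restr (id \<circ> s) D') \<in> r"
    unfolding D by (rule restr_left[OF assms(1) s(1) cofin_self])
  from restr_right_perm[OF this fin_perm_inv[OF s(1)] fin_perm_comp[OF pA s(1)]]
  show ?thesis using s(1) by (simp add: o_assoc fin_perm_inverses[OF s(1)])
qed

lemma perm_comp:
  assumes "(restr p D, restr id D) \<in> r" "(restr q D, restr id D) \<in> r" "fin_perm D p"
  shows "(restr (q \<circ> p) D, restr id D) \<in> r"
proof -
  have D: "cofin A D" using restr_cofin assms(1) by blast
  have pA: "fin_perm A p" using fin_perm_mono[OF assms(3)] D by (simp add: cofin_def)
  have "D \<inter> p -` D = D" using fin_perm_in[OF assms(3)] by auto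
  then have "(restr (q \<circ> p) D, restr p D) \<in> r"
    using restr_left[OF assms(2) pA D] by simp
  then show ?thesis using trans assms(1) by blast
qed

lemma perm_inv:
  assumes "(restr p D, restr id D) \<in> r" "fin_perm D p"
  shows "(restr (inv' p) D, restr id D) \<in> r"
proof -
  have D: "cofin A D" using restr_cofin assms(1) by blast
  have i: "fin_perm D (inv' p)" using assms(2) by (rule fin_perm_inv)
  have iA: "fin_perm A (inv' p)" using fin_perm_mono[OF i] D by (simp add: cofin_def)
  have "D \<inter> inv' p -` D = D" using fin_perm_in[OF i] by auto
  then have "(restr (p \<circ> inv' p) D, restr (inv' p) D) \<in> r"
    using restr_left[OF assms(1) iA D] by simp
  then show ?thesis using sym by (simp add: fin_perm_inverses[OF assms(2)])
qed

text \<open>One non-identity \<open>p\<close> settles the whole level: conjugation brings it to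
  every domain of the level, where its normal closure contains all even permutations, and all
  finitary ones if \<open>p\<close> is odd.\<close>

lemma twist_subset:
  assumes A: "infinite A"
    and ab: "(a, b) \<in> r" "fin_perm (dom a) p" "a = b \<circ> p" "p \<noteq> id"
    and o: "odd_ok \<longrightarrow> \<not> evenperm p"
  shows "twist odd_ok A (card (A - dom a)) \<subseteq> r"
proof (rule subrelI)
  fix c d assume "(c, d) \<in> twist odd_ok A (card (A - dom a))"
  then obtain t where t: "c \<in> carrier (I_inf A)" "d \<in> carrier (I_inf A)" "card (A - dom c) = card (A - dom a)"
    "dom d = dom c" "fin_perm (dom c) t" "odd_ok \<or> evenperm t" "c = d \<circ> t" by (rule twistE)
  have inf: "infinite D" if "cofin A D" for D
    using that A by (metis cofin_def finite_Diff2)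
  have ca: "cofin A (dom a)" and cc: "cofin A (dom c)"
    using cofin_dom in_carrier(1)[OF ab(1)] t(1) by blast+
  obtain x x' where "x \<in> dom a" "x' \<in> dom c"
    using inf[OF ca] inf[OF cc] by (metis all_not_in_conv finite.emptyI)
  then obtain s where s: "fin_perm A s" "\<And>y. y \<in> A \<Longrightarrow> s y \<in> dom a \<longleftrightarrow> y \<in> dom c"
    using cofin_transport[OF ca cc] t(3) by metis
  define p' where "p' = inv' s \<circ> p \<circ> s"
  have p'N: "(restr p' (dom c), restr id (dom c)) \<in> r"
    unfolding p'_def using perm_conj[OF perm_of_twist[OF ab(1-3)] ab(2) s cc] by blast
  have "s y \<in> dom a \<longleftrightarrow> y \<in> dom c" for y
    using s fin_perm_in[OF s(1), of y] ca cc by (cases "y \<in> A") (auto simp: cofin_def)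
  then have p': "fin_perm (dom c) p'"
    unfolding p'_def by (rule fin_perm_conj[OF ab(2) s(1)])
  have "p' \<noteq> id"
  proof
    assume "p' = id"
    then have "s \<circ> p' \<circ> inv' s = id" by (simp add: fin_perm_inverses[OF s(1)])
    moreover have "s \<circ> p' \<circ> inv' s = p"
      by (simp add: p'_def fun_eq_iff fin_perm_inverses[OF s(1)])
    ultimately show False using ab(4) by simp
  qed
  have ev: "evenperm p' = evenperm p"
    unfolding p'_def by (rule evenperm_conj[OF ab(2) s(1)])
  define N where "N = {p. fin_perm (dom c) p \<and> (restr p (dom c), restr id (dom c)) \<in> r}"
  have comp: "q \<circ> q' \<in> N" if "q \<in> N" "q' \<in> N" for q q'
    using that perm_comp fin_perm_comp by (auto simp: N_def)
  have inv: "inv' q \<in> N" if "q \<in> N" for q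
    using that perm_inv fin_perm_inv by (auto simp: N_def)
  have conj: "u \<circ> q \<circ> inv' u \<in> N" if "q \<in> N" "fin_perm (dom c) u" for q u
  proof -
    have u: "fin_perm A (inv' u)"
      using fin_perm_mono[OF fin_perm_inv[OF that(2)]] cc by (simp add: cofin_def)
    have "(restr (inv' (inv' u) \<circ> q \<circ> inv' u) (dom c), restr id (dom c)) \<in> r"
      using that fin_perm_in[OF fin_perm_inv[OF that(2)]]
      by (intro perm_conj[OF _ _ u _ cc]) (auto simp: N_def)
    then show ?thesis
      using that by (simp add: N_def fin_perm_comp fin_perm_inv fin_perm_inverses[OF that(2)])
  qed
  have p'': "p' \<in> N" using p' p'N by (simp add: N_def)
  have even: "q \<in> N" if "fin_perm (dom c) q" "evenperm q" for q
    using normal_contains_evenperm[where D = "dom c" and N = N and p = p' and q = q] inf[OF cc]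
      comp inv conj p'' p' \<open>p' \<noteq> id\<close> that by blast
  have "t \<in> N"
  proof (cases "evenperm t")
    case False
    have i: "fin_perm (dom c) (inv' p')" using p' by (rule fin_perm_inv)
    \<comment> \<open>An odd \<open>t\<close> is only allowed with \<open>odd_ok\<close>, and then
      \<open>p'\<close> is odd as well.\<close>
    have "evenperm (inv' p' \<circ> t)"
      using False t(6) o ev evenperm_fin_perm_comp[OF i t(5)] evenperm_fin_perm_inv[OF p'] by simp
    then have "inv' p' \<circ> t \<in> N" using even fin_perm_comp[OF i t(5)] by blast
    then have "p' \<circ> (inv' p' \<circ> t) \<in> N" using comp p'' by blast
    then show ?thesis by (simp add: o_assoc fin_perm_inverses[OF p'])
  qed (use even t in blast)
  then show "(c, d) \<in> r" using twist_of_perm[of t d] t by (auto simp: N_def)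
qed

section \<open>Assembling the classification\<close>

lemma congruence_cases:
  assumes A: "infinite A"
  shows "r = Delta (I_inf A) \<or> (\<exists>n. r = K_S A n) \<or> (\<exists>n. r = K_A A n) \<or> (\<exists>n. r = K_I A n)"
proof (cases "r \<subseteq> Delta (I_inf A)")
  case True
  moreover have "Delta (I_inf A) \<subseteq> r" using refl by (auto simp: Delta_def)
  ultimately show ?thesis by blast
next
  case False
  define P where "P n \<longleftrightarrow> (\<exists>a b. (a, b) \<in> r \<and> a \<noteq> b \<and> card (A - dom a) = n)" for n
  have "\<exists>n. P n" using False in_carrier(1) by (auto simp: P_def Delta_def)
  then obtain n where "P n" and least: "\<And>m. P m \<Longrightarrow> n \<le> m"
    using LeastI_ex[of P] Least_le[of P] by blast
  then obtain a0 b0 where ab0: "(a0, b0) \<in> r" "a0 \<noteq> b0" "card (A - dom a0) = n"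
    by (auto simp: P_def)
  \<comment> \<open>By symmetry of \<open>r\<close>, minimality of \<open>n\<close> bounds the level
    of both members.\<close>
  have sub: "a \<in> ideal_I A n \<and> b \<in> ideal_I A n" if "(a, b) \<in> r" "a \<noteq> b" for a b
    using that sym[OF that(1)] least[of "card (A - dom a)"] least[of "card (A - dom b)"] in_carrier
    unfolding ideal_I_def P_def by blast
  have I: "ideal_I A (n + 1) \<times> ideal_I A (n + 1) \<subseteq> r" using ideal_subset_Suc ab0 by blast
  have \<Delta>: "Delta (I_inf A) \<subseteq> r" using refl by (auto simp: Delta_def)
  show ?thesis
  proof (cases "\<exists>a b. (a, b) \<in> r \<and> card (A - dom a) = n \<and> (a, b) \<notin> green_H (I_inf A)")
    case True
    then obtain a b where ab: "(a, b) \<in> r" "card (A - dom a) = n" "(a, b) \<notin> green_H (I_inf A)" by blast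
    have C: "a \<in> carrier (I_inf A)" "b \<in> carrier (I_inf A)" using in_carrier[OF ab(1)] by auto
    then have "a \<noteq> b" using ab(3) by (auto simp: green_H_I_inf_iff)
    \<comment> \<open>\<open>b\<close> has level at least \<open>n\<close>, so nested domains
      coincide; since the pair is not H-related, the ranges then differ.\<close>
    then have "dom a = dom b" if "dom a \<subseteq> dom b"
      using that sub[OF ab(1)] ab(2) C by (intro cofin_eqI[where A = A] cofin_dom) (auto simp: ideal_I_def)
    then have "ideal_I A n \<times> ideal_I A n \<subseteq> r"
      using ideal_subset_dom[OF ab(1), of n] ideal_subset_ran[OF ab(1)] ab C
      by (cases "dom a \<subseteq> dom b") (auto simp: green_H_I_inf_iff)
    moreover have "r \<subseteq> K_I A n"
    proof (rule subrelI)
      fix a b assume ab: "(a, b) \<in> r"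
      then show "(a, b) \<in> K_I A n"
        using sub[OF ab] in_carrier(1)[OF ab] by (cases "a = b") (auto simp: K_I_def Delta_def)
    qed
    ultimately have "r = K_I A n" using \<Delta> unfolding K_I_def by blast
    then show ?thesis by blast
  next
    case False
    have tw: "\<exists>p. fin_perm (dom a) p \<and> a = b \<circ> p" if "(a, b) \<in> r" "card (A - dom a) = n" for a b
      using False that green_H_iff_perm in_carrier by metis
    \<comment> \<open>Upper bound for both remaining families: a pair with neither member on level
      \<open>n\<close> is trivial or lies in the next ideal.\<close>
    have up: "r \<subseteq> twist odd_ok A n \<union> ideal_I A (n + 1) \<times> ideal_I A (n + 1) \<union> Delta (I_inf A)"
      if o: "\<And>a b p. (a, b) \<in> r \<Longrightarrow> card (A - dom a) = n \<Longrightarrow> fin_perm (dom a) p \<Longrightarrow> a = b \<circ> p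
        \<Longrightarrow> odd_ok \<or> evenperm p" for odd_ok
    proof (rule subrelI)
      fix a b assume ab: "(a, b) \<in> r"
      have C: "a \<in> carrier (I_inf A)" "b \<in> carrier (I_inf A)" using in_carrier[OF ab] by auto
      have 1: "(c, d) \<in> twist odd_ok A n" if "(c, d) \<in> r" "card (A - dom c) = n" for c d
        using tw[OF that] o[OF that] in_carrier[OF that(1)] that(2) unfolding twist_def by blast
      show "(a, b) \<in> twist odd_ok A n \<union> ideal_I A (n + 1) \<times> ideal_I A (n + 1) \<union> Delta (I_inf A)"
      proof (cases "a = b \<or> card (A - dom a) = n \<or> card (A - dom b) = n")
        case True
        then consider "a = b" | "card (A - dom a) = n" | "card (A - dom b) = n" by blast
        then show ?thesis
          by cases (use C 1[OF ab] symD[OF sym_twist 1[OF sym[OF ab]]] in \<open>auto simp: Delta_def\<close>)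
      next
        case False
        then show ?thesis using sub[OF ab] by (auto simp: ideal_I_def)
      qed
    qed
    show ?thesis
    \<comment> \<open>An odd permutation on level \<open>n\<close> yields the whole finitary
      symmetric group; otherwise only even ones occur.\<close>
    proof (cases "\<exists>a b p. (a, b) \<in> r \<and> card (A - dom a) = n \<and> fin_perm (dom a) p \<and> a = b \<circ> p \<and> \<not> evenperm p")
      case True
      then obtain a b p where p: "(a, b) \<in> r" "card (A - dom a) = n" "fin_perm (dom a) p" "a = b \<circ> p"
        "\<not> evenperm p" by blast
      then have "p \<noteq> id" by auto
      then have "twist True A n \<subseteq> r" using twist_subset[OF A p(1,3,4), of True] p by simp
      moreover have "r \<subseteq> K_S A n" unfolding K_S_eq_twist by (rule up) simp
      ultimately have "r = K_S A n" unfolding K_S_eq_twist using I \<Delta> by blast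
      then show ?thesis by blast
    next
      case False
      obtain p where p: "fin_perm (dom a0) p" "a0 = b0 \<circ> p" using tw[OF ab0(1,3)] by blast
      then have "p \<noteq> id" using ab0(2) by auto
      then have "twist False A n \<subseteq> r" using twist_subset[OF A ab0(1) p, of False] ab0(3) by simp
      moreover have "r \<subseteq> K_A A n" unfolding K_A_eq_twist by (rule up) (use False in blast)
      ultimately have "r = K_A A n" unfolding K_A_eq_twist using I \<Delta> by blast
      then show ?thesis by blast
    qed
  qed
qed

end

theorem theorem3p14:
  fixes \<kappa> :: "'a rel"
  assumes "Card_order \<kappa>" and "infinite (Field \<kappa>)"
  shows "{Delta (I_inf (Field \<kappa>)), Omega (I_inf (Field \<kappa>))}
           \<union> {K_S (Field \<kappa>) n | n. n \<ge> 0}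
           \<union> {K_A (Field \<kappa>) n | n. n \<ge> 0}
           \<union> {K_I (Field \<kappa>) n | n. n \<ge> 1}
         = {r. congruence_on (I_inf (Field \<kappa>)) r}"
  (is "?F = _")
proof (intro equalityI subsetI)
  fix r assume "r \<in> ?F"
  then show "r \<in> {r. congruence_on (I_inf (Field \<kappa>)) r}"
    using congruence_on_Delta congruence_on_K_I[of "Field \<kappa>" 0] congruence_on_K_S
      congruence_on_K_A congruence_on_K_I K_I_0 by (auto simp: K_I_0)
next
  fix r assume "r \<in> {r. congruence_on (I_inf (Field \<kappa>)) r}"
  then interpret I_inf_congruence "Field \<kappa>" r by unfold_locales simp
  have "K_I (Field \<kappa>) n \<in> ?F" for n
    by (cases "n = 0") (auto simp: K_I_0)
  then show "r \<in> ?F" using congruence_cases[OF assms(2)] by auto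
qed

end
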